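(* Let $n\in\mathbb{N}$, $s\in\mathbb{C}\setminus\{-1,-2,-3,\dots\}$ and $x\in\mathbb{C}$. Then \begin{align*} &\sum_{k=1}^{n}\binom{s+n}{k}\{\psi(s+n+1)-\psi(s+n-k+1)\}x^k\\ &=(1+x)^n\sum_{k=0}^{n-1}\frac{\binom{s+k}{k}}{k+1}\{1+s[\psi(s+k+1)-\psi(s+1)]\}\left(\frac{x}{x+1}\right)^{k+1}. \end{align*}
   Context: $\psi=\Gamma'/\Gamma$ is the digamma function. For $z\in\mathbb{C}$ and $k\in\mathbb{N}_0$, $\binom{z}{k}=\frac{z(z-1)\cdots(z-k+1)}{k!}$. For $0\le k\le n-1$ the product $(1+x)^n\left(\frac{x}{x+1}\right)^{k+1}$ is understood as the polynomial $x^{k+1}(1+x)^{n-k-1}$, so the identity is meaningful for all $x\in\mathbb{C}$, including $x=-1$. *)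

theory Defs
  imports "HOL-Analysis.Analysis"
begin

end

theory Submission
  imports Defs
begin

text \<open>
  The identity is the derivative with respect to \<open>s\<close> of the polynomial identity
  \<open>(\<Sum>k\<le>n. ((s + n) gchoose k) * x ^ k) =
    (1 + x) ^ n + s * (\<Sum>k<n. ((s + k) gchoose k) / (k + 1) * x ^ (k + 1) * (1 + x) ^ (n - k - 1))\<close>,
  because the logarithmic derivative of \<open>z gchoose k\<close> is the digamma difference
  \<open>Digamma (z + 1) - Digamma (z - k + 1)\<close>. The polynomial identity follows by induction on \<open>n\<close> from
  Pascal's rule and \<open>(s + n) gchoose (n + 1) = s / (n + 1) * ((s + n) gchoose n)\<close>.
\<close>

lemma gbinomial_Suc_eq:
  fixes a :: "'a :: field_char_0"
  shows "a gchoose Suc k = (a gchoose k) * (a - of_nat k) / of_nat (Suc k)"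
  using gbinomial_mult_1[of a k] by (simp add: field_simps del: of_nat_Suc)

lemma sum_gbinomial_upper_shift:
  fixes s x :: "'a :: field_char_0"
  shows "(\<Sum>k\<le>n. ((s + of_nat n) gchoose k) * x ^ k) =
    (1 + x) ^ n + (\<Sum>k<n. s * ((s + of_nat k) gchoose k) / (of_nat k + 1)
      * (x ^ (k + 1) * (1 + x) ^ (n - k - 1)))"
proof (induction n)
  case 0
  show ?case by simp
next
  case (Suc n)
  define P where "P = (\<Sum>k\<le>n. ((s + of_nat n) gchoose k) * x ^ k)"
  \<comment> \<open>The exponent parameter \<open>m\<close> is separate from the range
    \<open>k < n\<close>, so multiplying by \<open>1 + x\<close> only moves \<open>m\<close> from
    \<open>n\<close> to \<open>Suc n\<close>; the new term \<open>k = n\<close> comes from the top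
    term left over by Pascal's rule.\<close>
  define Q where "Q m = (\<Sum>k<n. s * ((s + of_nat k) gchoose k) / (of_nat k + 1)
      * (x ^ (k + 1) * (1 + x) ^ (m - k - 1)))" for m
  have "(\<Sum>k\<le>Suc n. ((s + of_nat (Suc n)) gchoose k) * x ^ k) =
      1 + (\<Sum>k\<le>n. ((s + of_nat (Suc n)) gchoose Suc k) * x ^ Suc k)"
    by (subst sum.atMost_Suc_shift) simp
  also have "(s + of_nat (Suc n)) gchoose Suc k =
      ((s + of_nat n) gchoose k) + ((s + of_nat n) gchoose Suc k)" for k
    using gbinomial_Suc_Suc[of "s + of_nat n" k] by (simp add: add_ac)
  then have "1 + (\<Sum>k\<le>n. ((s + of_nat (Suc n)) gchoose Suc k) * x ^ Suc k) =
      x * P + (1 + (\<Sum>k\<le>n. ((s + of_nat n) gchoose Suc k) * x ^ Suc k))"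
    by (simp add: P_def sum.distrib sum_distrib_left algebra_simps)
  also have "1 + (\<Sum>k\<le>n. ((s + of_nat n) gchoose Suc k) * x ^ Suc k) =
      (\<Sum>k\<le>Suc n. ((s + of_nat n) gchoose k) * x ^ k)"
    by (subst sum.atMost_Suc_shift) simp
  also have "\<dots> = P + ((s + of_nat n) gchoose Suc n) * x ^ Suc n"
    by (simp add: P_def)
  \<comment> \<open>The last factor of the falling factorial is
    \<open>s + n - n = s\<close>.\<close>
  also have "(s + of_nat n) gchoose Suc n = s * ((s + of_nat n) gchoose n) / (of_nat n + 1)"
    by (simp add: gbinomial_Suc_eq add_ac mult_ac)
  finally have *: "(\<Sum>k\<le>Suc n. ((s + of_nat (Suc n)) gchoose k) * x ^ k) =
      (1 + x) * P + s * ((s + of_nat n) gchoose n) / (of_nat n + 1) * x ^ Suc n"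
    by (simp add: algebra_simps)
  have "P = (1 + x) ^ n + Q n"
    using Suc by (simp add: P_def Q_def)
  moreover have "(1 + x) * Q n = Q (Suc n)"
    unfolding Q_def sum_distrib_left
  proof (rule sum.cong)
    fix k assume "k \<in> {..<n}"
    \<comment> \<open>As \<open>k < n\<close>, the natural subtraction is not truncated and the
      exponent grows by exactly one.\<close>
    then have "(1 + x) ^ (Suc n - k - 1) = (1 + x) * (1 + x) ^ (n - k - 1)"
      by (simp flip: power_Suc add: Suc_diff_Suc)
    then show "(1 + x) * (s * ((s + of_nat k) gchoose k) / (of_nat k + 1)
        * (x ^ (k + 1) * (1 + x) ^ (n - k - 1))) =
      s * ((s + of_nat k) gchoose k) / (of_nat k + 1)
        * (x ^ (k + 1) * (1 + x) ^ (Suc n - k - 1))"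
      by (simp add: mult_ac)
  qed simp
  ultimately show ?case
    unfolding * by (simp add: Q_def algebra_simps)
qed

text \<open>By the recurrence of \<open>Digamma\<close>, the difference telescopes to the sum of
  \<open>1 / (z - j)\<close> over \<open>j < k\<close>, the logarithmic derivative of the falling
  factorial. The hypothesis keeps all its factors nonzero.\<close>

lemma has_field_derivative_gbinomial:
  fixes z :: complex
  assumes "\<And>j. j < k \<Longrightarrow> z \<noteq> of_nat j"
  shows "((\<lambda>z. z gchoose k) has_field_derivative
    (z gchoose k) * (Digamma (z + 1) - Digamma (z - of_nat k + 1))) (at z)"
  using assms
proof (induction k)
  case 0
  show ?case by simp
next
  case (Suc k)
  have nz: "z - of_nat k \<noteq> 0"
    using Suc.prems[of k] by simp
  \<comment> \<open>The summand \<open>1 / (z - k)\<close> accounts for the extra product-rule term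
    from the factor \<open>z - k\<close>.\<close>
  have dg: "Digamma (z - of_nat k + 1) = Digamma (z - of_nat k) + 1 / (z - of_nat k)"
    using Digamma_plus1[OF nz] .
  have "((\<lambda>z. z gchoose k) has_field_derivative
      (z gchoose k) * (Digamma (z + 1) - Digamma (z - of_nat k + 1))) (at z)"
    using Suc by simp
  then have "((\<lambda>z. (z gchoose k) * (z - of_nat k) / of_nat (Suc k)) has_field_derivative
      ((z gchoose k) * (Digamma (z + 1) - Digamma (z - of_nat k + 1)) * (z - of_nat k)
        + (z gchoose k)) / of_nat (Suc k)) (at z)"
    by (auto intro!: derivative_eq_intros simp del: of_nat_Suc)
  also have "((z gchoose k) * (Digamma (z + 1) - Digamma (z - of_nat k + 1)) * (z - of_nat k)
        + (z gchoose k)) / of_nat (Suc k) =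
      (z gchoose Suc k) * (Digamma (z + 1) - Digamma (z - of_nat k))"
    unfolding gbinomial_Suc_eq dg using nz by (simp add: field_simps del: of_nat_Suc)
  finally show ?case
    by (simp add: gbinomial_Suc_eq)
qed

theorem theorem2p2:
  fixes n :: nat and s x :: complex
  assumes "n \<ge> 1"
    and "s \<notin> {- of_nat m | m :: nat. m \<ge> 1}"
  shows "(\<Sum>k=1..n. ((s + of_nat n) gchoose k)
            * (Digamma (s + of_nat n + 1) - Digamma (s + of_nat n - of_nat k + 1)) * x ^ k)
       = (\<Sum>k=0..n-1. ((s + of_nat k) gchoose k) / (of_nat k + 1)
            * (1 + s * (Digamma (s + of_nat k + 1) - Digamma (s + 1)))
            * (x ^ (k + 1) * (1 + x) ^ (n - k - 1)))"
proof -
  have deriv: "((\<lambda>s. (s + of_nat m) gchoose k) has_field_derivative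
      ((s + of_nat m) gchoose k) * (Digamma (s + of_nat m + 1)
        - Digamma (s + of_nat m - of_nat k + 1))) (at s)" if "k \<le> m" for k m
  proof -
    \<comment> \<open>A zero factor would force \<open>s = -(m - j)\<close> with
      \<open>j < k \<le> m\<close>, an excluded negative integer.\<close>
    have "s + of_nat m \<noteq> of_nat j" if "j < k" for j
    proof
      assume "s + of_nat m = of_nat j"
      then have "s = - of_nat (m - j)"
        using \<open>k \<le> m\<close> \<open>j < k\<close> by (simp add: of_nat_diff algebra_simps)
      moreover have "m - j \<ge> 1"
        using \<open>k \<le> m\<close> \<open>j < k\<close> by simp
      ultimately show False
        using assms(2) by blast
    qed
    then show ?thesis
      using DERIV_shift[of "\<lambda>z. z gchoose k" _ s "of_nat m"] has_field_derivative_gbinomial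
      by blast
  qed
  define D where "D m k = ((s + of_nat m) gchoose k) * (Digamma (s + of_nat m + 1)
        - Digamma (s + of_nat m - of_nat k + 1))" for m k
  have L: "((\<lambda>s. \<Sum>k\<le>n. ((s + of_nat n) gchoose k) * x ^ k) has_field_derivative
      (\<Sum>k\<le>n. D n k * x ^ k)) (at s)"
    unfolding D_def by (intro DERIV_sum DERIV_cmult_right deriv) simp
  \<comment> \<open>Only the diagonal \<open>D k k\<close> occurs here, whose second digamma
    argument reduces to \<open>s + 1\<close>. The factor \<open>s\<close> contributes the summand 1
    of the final bracket.\<close>
  have "((\<lambda>s. (1 + x) ^ n + (\<Sum>k<n. s * ((s + of_nat k) gchoose k) / (of_nat k + 1)
        * (x ^ (k + 1) * (1 + x) ^ (n - k - 1)))) has_field_derivative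
      0 + (\<Sum>k<n. (1 * ((s + of_nat k) gchoose k) + D k k * s) / (of_nat k + 1)
        * (x ^ (k + 1) * (1 + x) ^ (n - k - 1)))) (at s)"
    unfolding D_def
    by (intro DERIV_add DERIV_const DERIV_sum DERIV_cmult_right DERIV_cdivide DERIV_mult
        DERIV_ident deriv) simp
  from DERIV_unique[OF L[unfolded sum_gbinomial_upper_shift] this]
  have "(\<Sum>k\<le>n. D n k * x ^ k) =
      (\<Sum>k<n. (((s + of_nat k) gchoose k) + D k k * s) / (of_nat k + 1)
        * (x ^ (k + 1) * (1 + x) ^ (n - k - 1)))"
    by simp
  also have "\<dots> = (\<Sum>k<n. ((s + of_nat k) gchoose k) / (of_nat k + 1)
        * (1 + s * (Digamma (s + of_nat k + 1) - Digamma (s + 1)))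
        * (x ^ (k + 1) * (1 + x) ^ (n - k - 1)))"
    by (intro sum.cong refl) (simp add: D_def algebra_simps add_divide_distrib diff_divide_distrib)
  \<comment> \<open>For \<open>n = 0\<close> the right-hand side would be \<open>{0}\<close>, hence
    the appeal to \<open>n \<ge> 1\<close>.\<close>
  also have "{..<n} = {0..n-1}"
    using assms(1) by auto
  \<comment> \<open>The term \<open>k = 0\<close> vanishes because its two digamma values
    coincide.\<close>
  also have "(\<Sum>k\<le>n. D n k * x ^ k) = (\<Sum>k=1..n. D n k * x ^ k)"
    by (rule sum.mono_neutral_right) (auto simp: D_def not_le)
  finally show ?thesis
    by (simp only: D_def)
qed

end
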